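(* Let $0<\alpha_0<\alpha_1<1$, let $\nu$ be the uniform probability distribution on $[\alpha_0,\alpha_1]$, and let $\Omega=[\alpha_0,\alpha_1]^{\mathbb Z}$, $P=\nu^{\mathbb Z}$. Then for $P$-almost every $\omega\in\Omega$, as $\ell\to\infty$, $$x_\ell(\omega)\sim\left[\frac{\log\ell}{c(\nu)\,\ell}\right]^{\frac1{\alpha_0}},\qquad\text{where } c(\nu)=\frac{\alpha_0^2\,2^{\alpha_0}}{\alpha_1-\alpha_0}.$$
   Context: For $0<\alpha<1$ the LSV map $f_\alpha:[0,1]\to[0,1]$ is $f_\alpha(x)=x(1+2^\alpha x^\alpha)$ for $x\in[0,\frac12]$ and $f_\alpha(x)=2x-1$ for $x\in(\frac12,1]$. For $\omega\in\Omega$ let $\alpha(\omega)\in[\alpha_0,\alpha_1]$ be its zeroth coordinate and $f_\omega:=f_{\alpha(\omega)}$; $\sigma$ is the left shift on $\Omega$. Define $x_1(\omega)=\frac12$ and $x_n(\omega)=\left(f_\omega|_{(0,1/2]}\right)^{-1}x_{n-1}(\sigma\omega)$ for $n\ge2$. The notation $a_\ell\sim b_\ell$ means $a_\ell/b_\ell\to1$. *)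

theory Defs
  imports "HOL-Probability.Probability"
begin

text \<open>The LSV map is a self-map of the interval from 0 to 1; its values outside that interval are
  irrelevant.\<close>

definition lsv :: "real \<Rightarrow> real \<Rightarrow> real" where
  "lsv \<alpha> x = (if x \<le> 1/2 then x * (1 + 2 powr \<alpha> * x powr \<alpha>) else 2 * x - 1)"

text \<open>The sample space is built into the measure: the marginal lives on the type of reals
  restricted to the interval, so that the space of the product is the full set of bi-infinite
  sequences in the interval (see \<open>space_P_unif\<close>).\<close>

definition nu_unif :: "real \<Rightarrow> real \<Rightarrow> real measure" where
  "nu_unif a b = uniform_measure (restrict_space lborel {a..b}) {a..b}"

definition P_unif :: "real \<Rightarrow> real \<Rightarrow> (int \<Rightarrow> real) measure" where
  "P_unif a b = PiM UNIV (\<lambda>_::int. nu_unif a b)"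

definition shift :: "(int \<Rightarrow> real) \<Rightarrow> (int \<Rightarrow> real)" where
  "shift \<omega> = (\<lambda>k. \<omega> (k + 1))"

abbreviation lsv_fiber :: "(int \<Rightarrow> real) \<Rightarrow> real \<Rightarrow> real" where
  "lsv_fiber \<omega> \<equiv> lsv (\<omega> 0)"

text \<open>The sequence is indexed from 1; its value at index 0 is deliberately left unspecified.\<close>

fun xseq :: "nat \<Rightarrow> (int \<Rightarrow> real) \<Rightarrow> real" where
  "xseq (Suc 0) \<omega> = 1/2"
| "xseq (Suc (Suc n)) \<omega> = inv_into {0<..1/2} (lsv_fiber \<omega>) (xseq (Suc n) (shift \<omega>))"

definition c_unif :: "real \<Rightarrow> real \<Rightarrow> real" where
  "c_unif a b = a\<^sup>2 * 2 powr a / (b - a)"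

lemma space_nu_unif: "space (nu_unif a b) = {a..b}"
  by (simp add: nu_unif_def space_restrict_space)

lemma space_P_unif: "space (P_unif a b) = UNIV \<rightarrow> {a..b}"
  by (simp add: P_unif_def space_PiM space_nu_unif PiE_def)

lemma prob_space_nu_unif: "a < b \<Longrightarrow> prob_space (nu_unif a b)"
  unfolding nu_unif_def
  by (rule prob_space_uniform_measure) (simp_all add: emeasure_restrict_space)

lemma prob_space_P_unif: "a < b \<Longrightarrow> prob_space (P_unif a b)"
  unfolding P_unif_def by (intro prob_space_PiM prob_space_nu_unif)

lemma emeasure_nu_unif:
  assumes "a < b" "A \<in> sets borel" "A \<subseteq> {a..b}"
  shows "emeasure (nu_unif a b) A = emeasure lborel A / ennreal (b - a)"
proof -
  have "A \<in> sets (restrict_space lborel {a..b})"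
    using assms by (auto simp: sets_restrict_space_iff)
  then show ?thesis
    using assms by (simp add: nu_unif_def emeasure_restrict_space sets_restrict_space_iff Int_absorb1)
qed

end

theory Submission
  imports Defs "HOL-Real_Asymp.Real_Asymp"
begin

text \<open>In the coordinate \<open>u = x powr (- a)\<close> with \<open>a = \<alpha>\<^sub>0\<close>, one inverse branch with parameter \<open>\<alpha>\<close> increases
  \<open>u\<close> by about \<open>a * 2 powr \<alpha> * u powr (1 - \<alpha> / a)\<close>, whose mean over \<open>\<alpha>\<close> is asymptotic to \<open>c / ln u\<close>.
  The value \<open>u\<^sub>l\<close> is obtained from \<open>u\<^sub>1\<close> by \<open>l - 1\<close> such steps, with parameters \<open>\<omega> (l - 2), \<dots>, \<omega> 0\<close>.
  The increment is decreasing in \<open>u\<close>, so freezing \<open>u\<close> at an upper or a lower bound replaces the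
  orbit by a sum of i.i.d. bounded variables, which Hoeffding's inequality and Borel-Cantelli control
  almost surely. Freezing at the trivial bound \<open>u \<le> 2 l\<close> gives the lower estimate. Applied to the
  first \<open>l / (ln l)\<^sup>2\<close> steps it gives \<open>u \<ge> l / (ln l) ^ 4\<close> from then on, and freezing at that value
  gives the upper estimate; both bounds have logarithm asymptotic to \<open>ln l\<close>, so both sums are
  asymptotic to \<open>c * l / ln l\<close>.\<close>

section \<open>One inverse branch in the coordinate \<open>u\<close>\<close>

definition incr :: "real \<Rightarrow> real \<Rightarrow> real \<Rightarrow> real" where
  "incr a w \<alpha> = a * 2 powr \<alpha> * w powr (1 - \<alpha> / a)"

lemma one_minus_powr_le:
  fixes a t :: real
  assumes "0 \<le> a" "0 \<le> t"
  shows "1 - (1 + t) powr (- a) \<le> a * t"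
proof -
  have "1 + (- a * ln (1 + t)) \<le> exp (- a * ln (1 + t))"
    by (rule exp_ge_add_one_self)
  moreover have "a * ln (1 + t) \<le> a * t"
    using assms by (intro mult_left_mono ln_add_one_self_le_self) auto
  ultimately show ?thesis
    using assms by (simp add: powr_def)
qed

text \<open>Each of two elementary estimates costs one factor \<open>1 + t\<close>: first
  \<open>ln (1 + t)\<close> is at least \<open>t / (1 + t)\<close>, then
  \<open>1 - 1 / (1 + s)\<close>, which equals \<open>s / (1 + s)\<close>, is at least
  \<open>s / (1 + t)\<close> because \<open>s \<le> t\<close>. The loss is harmless for the
  asymptotics since \<open>t\<close> tends to 0 along the orbit.\<close>

lemma one_minus_powr_ge:
  fixes a t :: real
  assumes "0 \<le> a" "a \<le> 1" "0 \<le> t"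
  shows "a * t / (1 + t)\<^sup>2 \<le> 1 - (1 + t) powr (- a)"
proof -
  define s where "s = a * t / (1 + t)"
  have s: "0 \<le> s" "s \<le> t"
  proof -
    have "a * t \<le> 1 * t" using assms by (intro mult_right_mono) auto
    also have "\<dots> \<le> t * (1 + t)" using assms by (simp add: algebra_simps)
    finally show "s \<le> t" using assms by (simp add: s_def divide_simps)
  qed (use assms in \<open>auto simp: s_def\<close>)
  have "t / (1 + t) \<le> ln (1 + t)"
    using ln_le_minus_one[of "1 / (1 + t)"] assms by (simp add: ln_div field_simps)
  then have "a * (t / (1 + t)) \<le> a * ln (1 + t)"
    using assms by (intro mult_left_mono) auto
  then have "1 + s \<le> 1 + a * ln (1 + t)" by (simp add: s_def)
  also have "\<dots> \<le> (1 + t) powr a"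
    using assms exp_ge_add_one_self[of "a * ln (1 + t)"] by (simp add: powr_def)
  finally have "(1 + t) powr (- a) \<le> 1 / (1 + s)"
    using s assms by (simp add: powr_minus divide_simps)
  moreover have "a * t / (1 + t)\<^sup>2 \<le> 1 - 1 / (1 + s)"
  proof -
    have "a * t / (1 + t)\<^sup>2 = s / (1 + t)" by (simp add: s_def power2_eq_square)
    also have "\<dots> \<le> s / (1 + s)" using s by (intro divide_left_mono) (auto intro!: mult_pos_pos)
    also have "\<dots> = 1 - 1 / (1 + s)" using s by (simp add: field_simps)
    finally show ?thesis .
  qed
  ultimately show ?thesis by linarith
qed

text \<open>The intermediate value theorem applies to the left branch, which runs from 0 to 1.
  Surjectivity is what turns \<open>inv_into\<close> into a right inverse of that branch.\<close>

lemma lsv_surj: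
  fixes \<alpha> y :: real
  assumes "0 < \<alpha>" "0 < y" "y \<le> 1"
  shows "y \<in> lsv \<alpha> ` {0<..1/2}"
proof -
  define g where "g = (\<lambda>x::real. x * (1 + 2 powr \<alpha> * x powr \<alpha>))"
  have "g 0 = 0" by (simp add: g_def)
  moreover have "g (1/2) = 1/2 * (1 + (2 * (1/2)) powr \<alpha>)"
    unfolding g_def by (subst powr_mult) auto
  then have "g (1/2) = 1" by simp
  moreover have "continuous_on {0..1/2} g"
    unfolding g_def using assms by (intro continuous_intros continuous_on_powr') auto
  ultimately obtain x where x: "0 \<le> x" "x \<le> 1/2" "g x = y"
    using IVT'[of g 0 y "1/2"] assms by auto
  with \<open>g 0 = 0\<close> assms have "x \<noteq> 0" by auto
  with x show ?thesis by (auto simp: lsv_def g_def intro!: image_eqI[of _ _ x])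
qed

text \<open>With \<open>u\<close>, \<open>v\<close> the coordinates of \<open>x\<close> and of its
  image, and \<open>t = (2 * x) powr \<alpha>\<close>, the relation
  \<open>v = u * (1 + t) powr (- a)\<close> is exact, and so is
  \<open>incr a u \<alpha> = u * (a * t)\<close>. The two bounds on
  \<open>1 - (1 + t) powr (- a)\<close> therefore place \<open>u - v\<close> between
  \<open>incr a u \<alpha> / (1 + t)\<^sup>2\<close> and \<open>incr a u \<alpha>\<close>. Since the
  exponent \<open>1 - \<alpha> / a\<close> is not positive, \<open>u\<close> may then be replaced by
  a smaller \<open>w\<close> or a larger \<open>W\<close>.\<close>

lemma lsv_preimage_bounds:
  fixes a \<alpha> x :: real
  assumes a: "0 < a" "a \<le> 1" "a \<le> \<alpha>" and x: "0 < x" "x \<le> 1/2"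
  shows lsv_preimage_upper:
      "\<lbrakk>0 < w; w \<le> lsv \<alpha> x powr (- a)\<rbrakk> \<Longrightarrow> x powr (- a) \<le> lsv \<alpha> x powr (- a) + incr a w \<alpha>"
    and lsv_preimage_lower:
      "\<lbrakk>0 < w; w \<le> lsv \<alpha> x powr (- a); x powr (- a) \<le> W\<rbrakk> \<Longrightarrow>
        lsv \<alpha> x powr (- a) + incr a W \<alpha> / (1 + 2 / w)\<^sup>2 \<le> x powr (- a)"
proof -
  define t u v where "t = (2 * x) powr \<alpha>" and "u = x powr (- a)" and "v = lsv \<alpha> x powr (- a)"
  have t: "0 < t" "t = 2 powr \<alpha> * x powr \<alpha>" using x by (auto simp: t_def powr_mult)
  have u: "0 < u" using x by (simp add: u_def)
  have "lsv \<alpha> x = x * (1 + t)" using x t by (simp add: lsv_def)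
  then have v: "v = u * (1 + t) powr (- a)"
    using x t(1) by (simp add: v_def u_def powr_mult)
  have "- a * (1 - \<alpha> / a) = \<alpha> - a" using a by (simp add: algebra_simps)
  then have "u powr (1 - \<alpha> / a) = x powr (\<alpha> - a)" by (simp only: u_def powr_powr)
  also have "\<dots> = x powr \<alpha> * u" using x by (simp add: u_def powr_diff powr_minus divide_simps)
  finally have incr_u: "incr a u \<alpha> = u * (a * t)" by (simp add: incr_def t(2))
  have mono: "incr a w2 \<alpha> \<le> incr a w1 \<alpha>" if "0 < w1" "w1 \<le> w2" for w1 w2
    using that a unfolding incr_def by (intro mult_left_mono powr_mono2') auto
  have "u * (1 - (1 + t) powr (- a)) \<le> u * (a * t)"
    using a t u by (intro mult_left_mono one_minus_powr_le) auto
  then have up: "u \<le> v + incr a u \<alpha>" by (simp add: v incr_u algebra_simps)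
  have "u * (a * t / (1 + t)\<^sup>2) \<le> u * (1 - (1 + t) powr (- a))"
    using a t u by (intro mult_left_mono one_minus_powr_ge) auto
  then have low: "v + incr a u \<alpha> / (1 + t)\<^sup>2 \<le> u" by (simp add: v incr_u algebra_simps)
  have "incr a u \<alpha> \<ge> 0" using a by (simp add: incr_def)
  then have "incr a u \<alpha> / (1 + t)\<^sup>2 \<ge> 0" by simp
  then have "v \<le> u" using low by linarith
  show "x powr (- a) \<le> lsv \<alpha> x powr (- a) + incr a w \<alpha>"
    if "0 < w" "w \<le> lsv \<alpha> x powr (- a)" for w
    using up mono[of w u] that \<open>v \<le> u\<close> unfolding u_def[symmetric] v_def[symmetric] by linarith
  show "lsv \<alpha> x powr (- a) + incr a W \<alpha> / (1 + 2 / w)\<^sup>2 \<le> x powr (- a)"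
    if w: "0 < w" "w \<le> lsv \<alpha> x powr (- a)" "x powr (- a) \<le> W" for w W
  proof -
    \<comment> \<open>Because \<open>2 * x \<le> 1\<close> and \<open>a \<le> \<alpha>\<close>, the
      exponent can be lowered to \<open>a\<close>. This makes the correction factor independent of
      \<open>\<alpha>\<close>, so that it can later be pulled out of the sum.\<close>
    have "t \<le> (2 * x) powr a" unfolding t_def using a x by (intro powr_mono') auto
    also have "\<dots> = 2 powr a / u" using x by (simp add: powr_mult u_def powr_minus divide_simps)
    also have "\<dots> \<le> 2 / w"
      using w a u \<open>v \<le> u\<close> powr_mono[of a 1 2] unfolding v_def[symmetric]
      by (intro frac_le) auto
    finally have "t \<le> 2 / w" .
    then have "incr a W \<alpha> / (1 + 2 / w)\<^sup>2 \<le> incr a u \<alpha> / (1 + t)\<^sup>2"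
      using w t u mono[of u W] a unfolding u_def[symmetric]
      by (intro frac_le power_mono) (auto simp: incr_def)
    with low show ?thesis unfolding u_def[symmetric] v_def[symmetric] by linarith
  qed
qed

section \<open>Iteration of the inverse branches along shifted samples\<close>

lemma funpow_shift: "(shift ^^ m) \<omega> = (\<lambda>k. \<omega> (k + int m))"
  by (induction m) (auto simp: shift_def algebra_simps)

lemma shift_int: "shift \<omega> (int j) = \<omega> (1 + int j)"
  by (simp add: shift_def add.commute)

lemma sum_int_interval_shift:
  assumes "l \<le> r"
  shows "(\<Sum>j<r - l. f (int j + int l)) = sum f {int l..<int r}"
  using assms
  by (intro sum.reindex_bij_witness[of _ "\<lambda>i. nat (i - int l)" "\<lambda>j. int j + int l"]) auto

locale lsv_params =
  fixes a b :: real
  assumes a_pos: "0 < a" and a_less_b: "a < b" and b_less_1: "b < 1"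
begin

abbreviation samples :: "(int \<Rightarrow> real) set" where
  "samples \<equiv> UNIV \<rightarrow> {a..b}"

lemma shift_samples: "\<omega> \<in> samples \<Longrightarrow> shift \<omega> \<in> samples"
  by (auto simp: shift_def)

lemma funpow_shift_samples: "\<omega> \<in> samples \<Longrightarrow> (shift ^^ m) \<omega> \<in> samples"
  by (auto simp: funpow_shift)

lemma xseq_bounds:
  assumes "\<omega> \<in> samples"
  shows "xseq (Suc n) \<omega> \<in> {0<..1/2}"
  using assms
proof (induction n arbitrary: \<omega>)
  case (Suc n)
  have "\<omega> 0 \<in> {a..b}" using Suc.prems by blast
  then have "0 < \<omega> 0" using a_pos by simp
  then have "xseq (Suc n) (shift \<omega>) \<in> lsv (\<omega> 0) ` {0<..1/2}"
    using Suc.IH[OF shift_samples[OF Suc.prems]] by (intro lsv_surj) auto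
  then show ?case unfolding xseq.simps by (rule inv_into_into)
qed simp

lemma lsv_xseq:
  assumes "\<omega> \<in> samples"
  shows "lsv (\<omega> 0) (xseq (Suc (Suc n)) \<omega>) = xseq (Suc n) (shift \<omega>)"
proof -
  have "\<omega> 0 \<in> {a..b}" using assms by blast
  then have "0 < \<omega> 0" using a_pos by simp
  then have "xseq (Suc n) (shift \<omega>) \<in> lsv (\<omega> 0) ` {0<..1/2}"
    using xseq_bounds[OF shift_samples[OF assms], of n] by (intro lsv_surj) auto
  then show ?thesis unfolding xseq.simps by (rule f_inv_into_f)
qed

definition U :: "nat \<Rightarrow> (int \<Rightarrow> real) \<Rightarrow> real" where
  "U n \<omega> = xseq n \<omega> powr (- a)"

lemma U_ge_1:
  assumes "\<omega> \<in> samples" "n \<ge> 1"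
  shows "1 \<le> U n \<omega>"
proof -
  obtain m where [simp]: "n = Suc m" using assms(2) by (cases n) auto
  have x: "0 < xseq n \<omega>" "xseq n \<omega> \<le> 1" using xseq_bounds[OF assms(1), of m] by auto
  then have "xseq n \<omega> powr 0 \<le> xseq n \<omega> powr (- a)"
    using a_pos by (intro powr_mono') auto
  with x show ?thesis by (simp add: U_def)
qed

text \<open>The thresholds \<open>w\<close> and \<open>W\<close> are free parameters instead of
  values of \<open>U\<close>, so that they can be kept constant when the step is iterated.\<close>

lemma
  assumes "\<omega> \<in> samples" "n \<ge> 1"
  shows U_Suc_upper: "\<lbrakk>0 < w; w \<le> U n (shift \<omega>)\<rbrakk> \<Longrightarrow> U (Suc n) \<omega> \<le> U n (shift \<omega>) + incr a w (\<omega> 0)"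
    and U_Suc_lower: "\<lbrakk>0 < w; w \<le> U n (shift \<omega>); U (Suc n) \<omega> \<le> W\<rbrakk> \<Longrightarrow>
           U n (shift \<omega>) + incr a W (\<omega> 0) / (1 + 2 / w)\<^sup>2 \<le> U (Suc n) \<omega>"
proof -
  obtain m where [simp]: "n = Suc m" using assms(2) by (cases n) auto
  have "\<omega> 0 \<in> {a..b}" using assms by blast
  then have "a \<le> \<omega> 0" by simp
  moreover have "0 < xseq (Suc n) \<omega>" "xseq (Suc n) \<omega> \<le> 1/2"
    using xseq_bounds[OF assms(1), of n] by (auto simp del: xseq.simps)
  moreover have "a \<le> 1" using a_less_b b_less_1 by simp
  ultimately show "\<lbrakk>0 < w; w \<le> U n (shift \<omega>)\<rbrakk> \<Longrightarrow> U (Suc n) \<omega> \<le> U n (shift \<omega>) + incr a w (\<omega> 0)"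
    and "\<lbrakk>0 < w; w \<le> U n (shift \<omega>); U (Suc n) \<omega> \<le> W\<rbrakk> \<Longrightarrow>
           U n (shift \<omega>) + incr a W (\<omega> 0) / (1 + 2 / w)\<^sup>2 \<le> U (Suc n) \<omega>"
    using lsv_preimage_upper[of a "\<omega> 0" "xseq (Suc n) \<omega>" w]
      lsv_preimage_lower[of a "\<omega> 0" "xseq (Suc n) \<omega>" w W] lsv_xseq[OF assms(1), of m] a_pos
    by (simp_all add: U_def del: xseq.simps)
qed

lemma incr_nonneg: "0 \<le> incr a w \<alpha>"
  using a_pos by (simp add: incr_def)

text \<open>The constant 2 serves twice: as the slope in the linear bound on \<open>U\<close>, and
  as the range of the summands in Hoeffding's inequality.\<close>

lemma incr_le_2:
  assumes "1 \<le> w" "\<alpha> \<in> {a..b}"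
  shows "incr a w \<alpha> \<le> 2"
proof -
  have "w powr (1 - \<alpha> / a) \<le> w powr 0"
    using assms a_pos by (intro powr_mono) auto
  moreover have "2 powr \<alpha> \<le> 2 powr 1"
    using assms b_less_1 by (intro powr_mono) auto
  ultimately have "a * 2 powr \<alpha> * w powr (1 - \<alpha> / a) \<le> 1 * 2 * 1"
    using a_pos a_less_b b_less_1 assms by (intro mult_mono) auto
  then show ?thesis by (simp add: incr_def)
qed

lemma U_le:
  assumes "\<omega> \<in> samples" "n \<ge> 1"
  shows "U n \<omega> \<le> 2 * real n"
  using assms(2,1)
proof (induction n arbitrary: \<omega> rule: dec_induct)
  case base
  have "2 powr a \<le> 2 powr 1" using a_less_b b_less_1 by (intro powr_mono) auto
  then show ?case by (simp add: U_def powr_divide powr_minus)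
next
  case (step n)
  have "shift \<omega> \<in> samples" using step.prems by (rule shift_samples)
  then have "U (Suc n) \<omega> \<le> U n (shift \<omega>) + incr a 1 (\<omega> 0)"
    using step by (intro U_Suc_upper U_ge_1) auto
  moreover have "incr a 1 (\<omega> 0) \<le> 2"
    using step.prems by (intro incr_le_2) auto
  ultimately show ?case using step.IH[OF \<open>shift \<omega> \<in> samples\<close>] by simp
qed

text \<open>Every step adds a nonnegative amount, by the lower one-step bound with
  \<open>w = 1\<close>. A threshold \<open>w\<close> reached at the start of a block of steps thus
  stays valid throughout the block.\<close>

lemma U_shift_le:
  assumes "\<omega> \<in> samples" "n \<ge> 1"
  shows "U n ((shift ^^ m) \<omega>) \<le> U (n + m) \<omega>"
  using assms(1)
proof (induction m arbitrary: \<omega>)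
  case (Suc m)
  have s: "shift \<omega> \<in> samples" using Suc.prems by (rule shift_samples)
  have "U (n + m) (shift \<omega>) + incr a (U (Suc (n + m)) \<omega>) (\<omega> 0) / (1 + 2 / 1)\<^sup>2 \<le> U (Suc (n + m)) \<omega>"
    using s Suc.prems assms(2) by (intro U_Suc_lower U_ge_1) auto
  moreover have "0 \<le> incr a (U (Suc (n + m)) \<omega>) (\<omega> 0) / (1 + 2 / 1)\<^sup>2"
    by (simp add: incr_nonneg)
  ultimately have "U (n + m) (shift \<omega>) \<le> U (Suc (n + m)) \<omega>" by linarith
  with Suc.IH[OF s] show ?case by (simp add: funpow_swap1)
qed simp

lemma U_upper:
  assumes "\<omega> \<in> samples" "n \<ge> 1" "0 < w" "w \<le> U n ((shift ^^ m) \<omega>)"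
  shows "U (n + m) \<omega> \<le> U n ((shift ^^ m) \<omega>) + (\<Sum>j<m. incr a w (\<omega> (int j)))"
  using assms(1,4)
proof (induction m arbitrary: \<omega>)
  case (Suc m)
  have s: "shift \<omega> \<in> samples" using Suc.prems(1) by (rule shift_samples)
  have w: "w \<le> U n ((shift ^^ m) (shift \<omega>))" using Suc.prems(2) by (simp add: funpow_swap1)
  also have "\<dots> \<le> U (n + m) (shift \<omega>)" using s assms(2) by (rule U_shift_le)
  finally have "U (Suc (n + m)) \<omega> \<le> U (n + m) (shift \<omega>) + incr a w (\<omega> 0)"
    using Suc.prems assms(2,3) by (intro U_Suc_upper) auto
  also have "U (n + m) (shift \<omega>) \<le> U n ((shift ^^ m) (shift \<omega>)) + (\<Sum>j<m. incr a w (shift \<omega> (int j)))"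
    by (rule Suc.IH[OF s w])
  finally show ?case
    by (simp add: funpow_swap1 sum.lessThan_Suc_shift shift_int add_ac del: sum.lessThan_Suc)
qed simp

text \<open>The bound on \<open>W\<close> dominates every value in the block by \<open>U_le\<close>,
  as \<open>2 * real (n + m)\<close> grows with \<open>m\<close>. A single \<open>W\<close> and a
  single correction factor therefore suffice for all steps.\<close>

lemma U_lower:
  assumes "\<omega> \<in> samples" "n \<ge> 1" "0 < w" "w \<le> U n ((shift ^^ m) \<omega>)" "2 * real (n + m) \<le> W"
  shows "U n ((shift ^^ m) \<omega>) + (\<Sum>j<m. incr a W (\<omega> (int j))) / (1 + 2 / w)\<^sup>2 \<le> U (n + m) \<omega>"
  using assms(1,4,5)
proof (induction m arbitrary: \<omega>)
  case (Suc m)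
  have s: "shift \<omega> \<in> samples" using Suc.prems(1) by (rule shift_samples)
  have w: "w \<le> U n ((shift ^^ m) (shift \<omega>))" using Suc.prems(2) by (simp add: funpow_swap1)
  have "U n ((shift ^^ m) (shift \<omega>)) + (\<Sum>j<m. incr a W (shift \<omega> (int j))) / (1 + 2 / w)\<^sup>2
      \<le> U (n + m) (shift \<omega>)"
    using Suc.IH[OF s w] Suc.prems(3) by simp
  moreover from w have "w \<le> U (n + m) (shift \<omega>)"
    using U_shift_le[OF s assms(2), of m] by linarith
  then have "U (n + m) (shift \<omega>) + incr a W (\<omega> 0) / (1 + 2 / w)\<^sup>2 \<le> U (Suc (n + m)) \<omega>"
    using Suc.prems assms(2,3) U_le[OF Suc.prems(1), of "Suc (n + m)"]
    by (intro U_Suc_lower) auto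
  ultimately show ?case
    by (simp add: funpow_swap1 sum.lessThan_Suc_shift shift_int add_ac add_divide_distrib
        del: sum.lessThan_Suc)
qed simp

definition mean_incr :: "real \<Rightarrow> real" where
  "mean_incr w = (\<integral>\<alpha>. incr a w \<alpha> \<partial>nu_unif a b)"

lemma integral_nu_unif:
  fixes f :: "real \<Rightarrow> real"
  assumes "f \<in> borel_measurable borel"
  shows "(\<integral>x. f x \<partial>nu_unif a b) = (\<integral>x. f x * indicator {a..b} x \<partial>lborel) / (b - a)"
proof -
  let ?R = "restrict_space lborel {a..b}"
  have "nu_unif a b = density ?R (\<lambda>_. ennreal (1 / (b - a)))"
    unfolding nu_unif_def uniform_measure_def
  proof (intro density_cong)
    have "1 / ennreal (b - a) = ennreal (1 / (b - a))"
      using a_less_b by (simp add: divide_ennreal flip: ennreal_1)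
    then show "AE x in ?R. indicator {a..b} x / emeasure ?R {a..b} = ennreal (1 / (b - a))"
      using a_less_b by (auto simp: AE_restrict_space_iff emeasure_restrict_space)
    have "{a..b} \<in> sets ?R" by (auto simp: sets_restrict_space_iff)
    then show "(\<lambda>x. indicator {a..b} x / emeasure ?R {a..b}) \<in> borel_measurable ?R"
      by measurable
  qed auto
  then have "(\<integral>x. f x \<partial>nu_unif a b) = (\<integral>x. (1 / (b - a)) *\<^sub>R f x \<partial>?R)"
    using a_less_b assms by (simp add: integral_density measurable_restrict_space1)
  also have "\<dots> = (\<integral>x. f x * indicator {a..b} x \<partial>lborel) / (b - a)"
    by (simp add: integral_restrict_space mult_ac)
  finally show ?thesis .
qed

lemma incr_measurable [measurable]: "incr a w \<in> borel_measurable borel"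
  unfolding incr_def by measurable

text \<open>As a function of \<open>\<alpha>\<close> the increment is a pure exponential, so its
  integral is elementary. The hypothesis on \<open>w\<close> makes the decay rate, and hence the
  denominator \<open>ln w - a * ln 2\<close>, positive.\<close>

lemma mean_incr_eq:
  assumes "2 powr a < w"
  shows "mean_incr w = a\<^sup>2 * 2 powr a / (b - a) * (1 - 2 powr (b - a) * w powr (1 - b / a)) / (ln w - a * ln 2)"
proof -
  have w: "0 < w" using assms by (rule le_less_trans[rotated]) simp
  have "ln (2 powr a) < ln w" using assms w by (subst ln_less_cancel_iff) auto
  then have d: "ln w - a * ln 2 > 0" by simp
  \<comment> \<open>The exponential has rate \<open>- (ln w - a * ln 2) / a\<close>; dividing
    \<open>incr a w \<alpha>\<close> by it yields the sign and the second factor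
    \<open>a\<close>.\<close>
  define F where "F = (\<lambda>\<alpha>. - (a\<^sup>2 * 2 powr \<alpha> * w powr (1 - \<alpha> / a)) / (ln w - a * ln 2))"
  have "(\<integral>\<alpha>. incr a w \<alpha> * indicator {a..b} \<alpha> \<partial>lborel) = F b - F a"
  proof (rule integral_FTC_Icc_real)
    show "(F has_real_derivative incr a w \<alpha>) (at \<alpha>)" for \<alpha>
    proof -
      define E where "E = (\<lambda>\<alpha>. exp (\<alpha> * ln 2 + (1 - \<alpha> / a) * ln w))"
      have E: "2 powr \<alpha> * w powr (1 - \<alpha> / a) = E \<alpha>" for \<alpha>
        using w by (simp add: E_def powr_def exp_add)
      have cancel: "- a\<^sup>2 / D * (e * (- D / a)) = a * e" if "D \<noteq> 0" for D e :: real
        using that a_pos by (simp add: power2_eq_square)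
      have "(E has_real_derivative E \<alpha> * (ln 2 - ln w / a)) (at \<alpha>)"
        unfolding E_def using a_pos by (auto intro!: derivative_eq_intros simp: algebra_simps)
      then have "((\<lambda>\<alpha>. - a\<^sup>2 / (ln w - a * ln 2) * E \<alpha>) has_real_derivative
          - a\<^sup>2 / (ln w - a * ln 2) * (E \<alpha> * (ln 2 - ln w / a))) (at \<alpha>)"
        by (rule DERIV_cmult)
      also have "(\<lambda>\<alpha>. - a\<^sup>2 / (ln w - a * ln 2) * E \<alpha>) = F"
        by (simp add: F_def fun_eq_iff mult.assoc E)
      also have "ln 2 - ln w / a = - (ln w - a * ln 2) / a"
        using a_pos by (simp add: field_simps)
      also have "- a\<^sup>2 / (ln w - a * ln 2) * (E \<alpha> * (- (ln w - a * ln 2) / a)) = a * E \<alpha>"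
        by (rule cancel) (use d in simp)
      also have "a * E \<alpha> = incr a w \<alpha>" by (simp add: incr_def mult.assoc E)
      finally show ?thesis .
    qed
    show "isCont (incr a w) \<alpha>" for \<alpha>
      unfolding incr_def using w a_pos by (intro continuous_intros) auto
  qed (use a_less_b in auto)
  also have "F b - F a = a\<^sup>2 * 2 powr a * (1 - 2 powr (b - a) * w powr (1 - b / a)) / (ln w - a * ln 2)"
  proof -
    have "2 powr b = 2 powr a * 2 powr (b - a)" by (simp flip: powr_add)
    then show ?thesis using a_pos w by (simp add: F_def algebra_simps diff_divide_distrib)
  qed
  finally show ?thesis
    by (simp add: mean_incr_def integral_nu_unif mult_ac)
qed

text \<open>The contribution of the endpoint \<open>b\<close> vanishes since
  \<open>1 - b / a < 0\<close>. The endpoint \<open>a\<close> alone gives the constant, and the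
  integration supplies the factor \<open>1 / ln w\<close>, the origin of the logarithm in the
  theorem.\<close>

lemma mean_incr_asymp: "((\<lambda>w. mean_incr w * ln w) \<longlongrightarrow> c_unif a b) at_top"
proof -
  have "1 - b / a < 0" using a_pos a_less_b by simp
  then have "((\<lambda>w::real. a\<^sup>2 * 2 powr a / (b - a) * (1 - 2 powr (b - a) * w powr (1 - b / a)) /
      (ln w - a * ln 2) * ln w) \<longlongrightarrow> a\<^sup>2 * 2 powr a / (b - a)) at_top"
    by real_asymp
  then have "((\<lambda>w. mean_incr w * ln w) \<longlongrightarrow> a\<^sup>2 * 2 powr a / (b - a)) at_top"
    by (rule Lim_transform_eventually)
       (use eventually_gt_at_top[of "2 powr a"] in eventually_elim, simp add: mean_incr_eq)
  then show ?thesis by (simp add: c_unif_def)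
qed

section \<open>Independence, concentration and Borel-Cantelli for frozen sums\<close>

lemma measurable_nu_unif:
  assumes "f \<in> borel_measurable borel"
  shows "f \<in> borel_measurable (nu_unif a b)"
proof -
  have "f \<in> borel_measurable (restrict_space lborel {a..b})"
    using assms by (intro measurable_restrict_space1) simp
  then show ?thesis
    by (simp add: nu_unif_def cong: measurable_cong_sets)
qed

lemma coordinate_measurable [measurable]: "(\<lambda>\<omega>. \<omega> i) \<in> measurable (P_unif a b) borel"
proof -
  have "(\<lambda>\<omega>. \<omega> i) \<in> measurable (P_unif a b) (nu_unif a b)"
    unfolding P_unif_def by (rule measurable_component_singleton) simp
  moreover have "(\<lambda>x. x) \<in> measurable (nu_unif a b) borel"
    by (simp add: measurable_nu_unif)
  ultimately show ?thesis by (rule measurable_compose)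
qed

lemma expectation_incr: "(\<integral>\<omega>. incr a w (\<omega> i) \<partial>P_unif a b) = mean_incr w"
proof -
  have m: "incr a w \<in> borel_measurable (nu_unif a b)"
    by (simp add: measurable_nu_unif)
  have "mean_incr w = (\<integral>\<alpha>. incr a w \<alpha> \<partial>distr (P_unif a b) (nu_unif a b) (\<lambda>\<omega>. \<omega> i))"
    unfolding P_unif_def mean_incr_def
    by (subst distr_PiM_component) (use prob_space_nu_unif[OF a_less_b] in auto)
  also have "\<dots> = (\<integral>\<omega>. incr a w (\<omega> i) \<partial>P_unif a b)"
    using m by (intro integral_distr) (auto simp: P_unif_def)
  finally show ?thesis by simp
qed

lemma mean_incr_nonneg: "0 \<le> mean_incr w"
  unfolding mean_incr_def by (intro Bochner_Integration.integral_nonneg incr_nonneg)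

text \<open>The coordinates are independent because their joint law, the law of the identity map, is
  the product of the marginals; measurable images of independent variables are again
  independent.\<close>

lemma indep_incr:
  "prob_space.indep_vars (P_unif a b) (\<lambda>_. borel) (\<lambda>i \<omega>. incr a w (\<omega> i)) J"
proof -
  interpret P: prob_space "P_unif a b" by (rule prob_space_P_unif[OF a_less_b])
  have "P.indep_vars (\<lambda>_. nu_unif a b) (\<lambda>i \<omega>. \<omega> i) UNIV"
  proof (subst P.indep_vars_iff_distr_eq_PiM')
    have "distr (P_unif a b) (nu_unif a b) (\<lambda>\<omega>. \<omega> i) = nu_unif a b" for i
      unfolding P_unif_def
      by (subst distr_PiM_component) (use prob_space_nu_unif[OF a_less_b] in auto)
    moreover have "(\<lambda>\<omega>. \<lambda>i\<in>UNIV. \<omega> i) = (\<lambda>\<omega>::int \<Rightarrow> real. \<omega>)" by (simp add: fun_eq_iff)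
    ultimately show "distr (P_unif a b) (Pi\<^sub>M UNIV (\<lambda>_. nu_unif a b)) (\<lambda>\<omega>. \<lambda>i\<in>UNIV. \<omega> i) =
        Pi\<^sub>M UNIV (\<lambda>i. distr (P_unif a b) (nu_unif a b) (\<lambda>\<omega>. \<omega> i))"
      by (simp add: P_unif_def distr_id2)
  qed (auto simp: P_unif_def)
  then have "P.indep_vars (\<lambda>_. nu_unif a b) (\<lambda>i \<omega>. \<omega> i) J"
    by (rule P.indep_vars_subset) simp
  then show ?thesis
    by (rule P.indep_vars_compose2) (simp add: measurable_nu_unif)
qed

text \<open>In Hoeffding's inequality the summands range over an interval of length 2, so the
  squared lengths add up to \<open>4 * card J\<close>, which gives the denominator
  \<open>2 * card J\<close> in the exponent.\<close>

lemma incr_sum_concentration: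
  assumes "finite J" "J \<noteq> {}" "1 \<le> w" "0 \<le> \<epsilon>"
  shows "measure (P_unif a b) {\<omega> \<in> space (P_unif a b).
      \<bar>(\<Sum>j\<in>J. incr a w (\<omega> j)) - card J * mean_incr w\<bar> \<ge> \<epsilon>} \<le> 2 * exp (- \<epsilon>\<^sup>2 / (2 * card J))"
proof -
  interpret P: prob_space "P_unif a b" by (rule prob_space_P_unif[OF a_less_b])
  interpret H: Hoeffding_ineq "P_unif a b" J "\<lambda>i \<omega>. incr a w (\<omega> i)" "\<lambda>_. 0" "\<lambda>_. 2"
      "\<Sum>i\<in>J. \<integral>\<omega>. incr a w (\<omega> i) \<partial>P_unif a b"
  proof unfold_locales
    fix i assume "i \<in> J"
    show "AE \<omega> in P_unif a b. incr a w (\<omega> i) \<in> {0..2}"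
      using assms(3) by (intro AE_I2) (auto simp: space_P_unif incr_nonneg intro!: incr_le_2)
  qed (auto simp: assms indep_incr)
  have "0 < card J" using assms by (simp add: card_gt_0_iff)
  then show ?thesis
    using H.Hoeffding_ineq_abs_ge[OF assms(4)] by (simp add: expectation_incr)
qed

text \<open>Both the summands and the index set change with \<open>l\<close>, so this is a law of
  large numbers for an array. The hypothesis \<open>big\<close> makes the deviation probabilities
  summable in \<open>l\<close>, and Borel-Cantelli applies.\<close>

lemma incr_sum_AE:
  fixes w :: "nat \<Rightarrow> real" and J :: "nat \<Rightarrow> int set"
  assumes fin: "\<And>l. finite (J l)" and w: "eventually (\<lambda>l. 1 \<le> w l) sequentially"
    and big: "filterlim (\<lambda>l. card (J l) * (mean_incr (w l))\<^sup>2 / ln (real l)) at_top sequentially"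
  shows "AE \<omega> in P_unif a b.
    (\<lambda>l. (\<Sum>j\<in>J l. incr a (w l) (\<omega> j)) / (card (J l) * mean_incr (w l))) \<longlonglongrightarrow> 1"
proof -
  interpret P: prob_space "P_unif a b" by (rule prob_space_P_unif[OF a_less_b])
  define S where "S = (\<lambda>l \<omega>. \<Sum>j\<in>J l. incr a (w l) (\<omega> j))"
  define m where "m = (\<lambda>l. card (J l) * mean_incr (w l))"
  have pos: "eventually (\<lambda>l. 0 < m l \<and> J l \<noteq> {}) sequentially"
    using filterlim_at_top_dense[THEN iffD1, OF big, rule_format, of 0]
  proof eventually_elim
    case (elim l)
    then have "real (card (J l)) \<noteq> 0" "mean_incr (w l) \<noteq> 0"
      by (auto simp del: of_nat_eq_0_iff)
    then have "0 < real (card (J l))" "0 < mean_incr (w l)" "J l \<noteq> {}"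
      using mean_incr_nonneg[of "w l"] by auto
    then show ?case by (simp add: m_def)
  qed
  have AE_eps: "AE \<omega> in P_unif a b. eventually (\<lambda>l. \<bar>S l \<omega> / m l - 1\<bar> < \<epsilon>) sequentially"
    if \<epsilon>: "0 < \<epsilon>" for \<epsilon>
  proof -
    define A where "A = (\<lambda>l. {\<omega> \<in> space (P_unif a b). \<bar>S l \<omega> - m l\<bar> \<ge> \<epsilon> * m l})"
    have A: "A l \<in> sets (P_unif a b)" for l
      unfolding A_def S_def by measurable
    \<comment> \<open>The threshold \<open>4 / \<epsilon>\<^sup>2\<close> for \<open>big\<close>
      forces the Hoeffding exponent \<open>\<epsilon>\<^sup>2 / 2 * (card (J l) * (mean_incr (w
      l))\<^sup>2)\<close> above \<open>2 * ln (real l)\<close>, hence the summable bound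
      \<open>2 / l ^ 2\<close>.\<close>
    have "eventually (\<lambda>l. norm (measure (P_unif a b) (A l)) \<le> 2 * (1 / real l ^ 2)) sequentially"
      using pos w filterlim_at_top_dense[THEN iffD1, OF big, rule_format, of "4 / \<epsilon>\<^sup>2"]
        eventually_gt_at_top[of 1]
    proof eventually_elim
      case (elim l)
      then have c: "0 < card (J l)" using fin by (simp add: card_gt_0_iff)
      have "measure (P_unif a b) (A l) \<le> 2 * exp (- (\<epsilon> * m l)\<^sup>2 / (2 * card (J l)))"
        unfolding A_def S_def m_def using elim \<epsilon>
        by (intro incr_sum_concentration fin) (auto simp: m_def)
      also have "(\<epsilon> * m l)\<^sup>2 / (2 * card (J l)) = \<epsilon>\<^sup>2 / 2 * (card (J l) * (mean_incr (w l))\<^sup>2)"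
        using c by (simp add: m_def power2_eq_square)
      then have "exp (- (\<epsilon> * m l)\<^sup>2 / (2 * card (J l))) \<le> exp (- (2 * ln (real l)))"
        using elim \<epsilon> by (simp add: field_simps)
      also have "\<dots> = 1 / real l ^ 2"
        using elim by (simp add: exp_minus divide_inverse exp_double)
      finally show ?case by simp
    qed
    moreover have "summable (\<lambda>l. 2 * (1 / real l ^ 2))"
      using inverse_power_summable[of 2, where 'a = real]
      by (intro summable_mult) (simp add: field_simps)
    ultimately have "summable (\<lambda>l. measure (P_unif a b) (A l))"
      by (rule summable_comparison_test_ev)
    then have "AE \<omega> in P_unif a b. eventually (\<lambda>l. \<omega> \<in> space (P_unif a b) - A l) sequentially"
      using A by (intro borel_cantelli_AE1) (auto simp: P.emeasure_eq_measure)
    then show ?thesis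
    proof (rule AE_mp, intro AE_I2 impI)
      fix \<omega> assume "eventually (\<lambda>l. \<omega> \<in> space (P_unif a b) - A l) sequentially"
      with pos show "eventually (\<lambda>l. \<bar>S l \<omega> / m l - 1\<bar> < \<epsilon>) sequentially"
      proof eventually_elim
        case (elim l)
        then have "\<bar>S l \<omega> - m l\<bar> / m l < \<epsilon>" by (auto simp: A_def divide_simps)
        moreover have "S l \<omega> / m l - 1 = (S l \<omega> - m l) / m l" using elim by (simp add: field_simps)
        ultimately show ?case using elim by (simp add: abs_divide)
      qed
    qed
  qed
  \<comment> \<open>The exceptional null set depends on the tolerance; restricting to the tolerances
    \<open>1 / real (Suc n)\<close> leaves a countable union of null sets.\<close>
  have "AE \<omega> in P_unif a b. \<forall>n. eventually (\<lambda>l. \<bar>S l \<omega> / m l - 1\<bar> < 1 / real (Suc n)) sequentially"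
    unfolding AE_all_countable by (intro allI AE_eps) auto
  then have "AE \<omega> in P_unif a b. (\<lambda>l. S l \<omega> / m l) \<longlonglongrightarrow> 1"
  proof (rule AE_mp, intro AE_I2 impI tendstoI)
    fix \<omega> and e :: real
    assume *: "\<forall>n. eventually (\<lambda>l. \<bar>S l \<omega> / m l - 1\<bar> < 1 / real (Suc n)) sequentially" and "0 < e"
    then obtain n where "1 / real (Suc n) < e" using nat_approx_posE by blast
    then show "eventually (\<lambda>l. dist (S l \<omega> / m l) 1 < e) sequentially"
      using *[rule_format, of n] by (auto elim!: eventually_mono simp: dist_real_def)
  qed
  then show ?thesis by (simp add: S_def m_def)
qed

section \<open>Frozen sums on the logarithmic scale\<close>

lemma c_unif_pos: "0 < c_unif a b"
  using a_pos a_less_b by (simp add: c_unif_def)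

text \<open>To leading order the mean depends on \<open>w\<close> only through \<open>ln w\<close>.
  This is why freezing at \<open>2 * l\<close> and at \<open>l / (ln l) ^ 4\<close> produces the
  same constant.\<close>

lemma mean_incr_seq_asymp:
  fixes w :: "nat \<Rightarrow> real"
  assumes "filterlim w at_top sequentially" "(\<lambda>l. ln (w l) / ln (real l)) \<longlonglongrightarrow> 1"
  shows "(\<lambda>l. mean_incr (w l) * ln (real l)) \<longlonglongrightarrow> c_unif a b"
proof -
  have "(\<lambda>l. mean_incr (w l) * ln (w l)) \<longlonglongrightarrow> c_unif a b"
    using filterlim_compose[OF mean_incr_asymp assms(1)] by simp
  from tendsto_divide[OF this assms(2)]
  have "(\<lambda>l. mean_incr (w l) * ln (w l) / (ln (w l) / ln (real l))) \<longlonglongrightarrow> c_unif a b" by simp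
  moreover have "eventually (\<lambda>l. mean_incr (w l) * ln (w l) / (ln (w l) / ln (real l)) =
      mean_incr (w l) * ln (real l)) sequentially"
    using filterlim_at_top_dense[THEN iffD1, OF assms(1), rule_format, of 1]
    by eventually_elim simp
  ultimately show ?thesis by (rule Lim_transform_eventually)
qed

text \<open>Since the mean is asymptotic to \<open>c / ln l\<close>, the quantity required to
  diverge in \<open>incr_sum_AE\<close> behaves like
  \<open>c\<^sup>2 * card (J l) / (ln l) ^ 3\<close>; hence the cube in the last hypothesis.\<close>

lemma incr_sum_asymp:
  fixes w :: "nat \<Rightarrow> real" and J :: "nat \<Rightarrow> int set"
  assumes fin: "\<And>l. finite (J l)"
    and w: "filterlim w at_top sequentially" "(\<lambda>l. ln (w l) / ln (real l)) \<longlonglongrightarrow> 1"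
    and J: "filterlim (\<lambda>l. card (J l) / ln (real l) ^ 3) at_top sequentially"
  shows "AE \<omega> in P_unif a b.
    (\<lambda>l. (\<Sum>j\<in>J l. incr a (w l) (\<omega> j)) * ln (real l) / card (J l)) \<longlonglongrightarrow> c_unif a b"
proof -
  note h = mean_incr_seq_asymp[OF w]
  have "filterlim (\<lambda>l. (mean_incr (w l) * ln (real l))\<^sup>2 * (card (J l) / ln (real l) ^ 3))
      at_top sequentially"
    using c_unif_pos by (intro filterlim_tendsto_pos_mult_at_top[OF tendsto_power[OF h] _ J]) simp
  moreover have "eventually (\<lambda>l. (mean_incr (w l) * ln (real l))\<^sup>2 * (card (J l) / ln (real l) ^ 3) =
      card (J l) * (mean_incr (w l))\<^sup>2 / ln (real l)) sequentially"
    using eventually_gt_at_top[of 1]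
    by eventually_elim (simp add: power2_eq_square power3_eq_cube)
  ultimately have big:
    "filterlim (\<lambda>l. card (J l) * (mean_incr (w l))\<^sup>2 / ln (real l)) at_top sequentially"
    by (rule filterlim_mono_eventually[OF _ order_refl order_refl])
  have "eventually (\<lambda>l. 1 \<le> w l) sequentially"
    using w(1) by (simp add: filterlim_at_top)
  from incr_sum_AE[OF fin this big] show ?thesis
  proof (rule AE_mp, intro AE_I2 impI)
    fix \<omega>
    assume "(\<lambda>l. (\<Sum>j\<in>J l. incr a (w l) (\<omega> j)) / (card (J l) * mean_incr (w l))) \<longlonglongrightarrow> 1"
    from tendsto_mult[OF this h] have "(\<lambda>l. (\<Sum>j\<in>J l. incr a (w l) (\<omega> j)) /
        (card (J l) * mean_incr (w l)) * (mean_incr (w l) * ln (real l))) \<longlonglongrightarrow> c_unif a b"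
      by simp
    moreover have "eventually (\<lambda>l. (\<Sum>j\<in>J l. incr a (w l) (\<omega> j)) /
        (card (J l) * mean_incr (w l)) * (mean_incr (w l) * ln (real l)) =
        (\<Sum>j\<in>J l. incr a (w l) (\<omega> j)) * ln (real l) / card (J l)) sequentially"
      using order_tendstoD(1)[OF h c_unif_pos]
      by eventually_elim auto
    ultimately show "(\<lambda>l. (\<Sum>j\<in>J l. incr a (w l) (\<omega> j)) * ln (real l) / card (J l))
        \<longlonglongrightarrow> c_unif a b"
      by (rule Lim_transform_eventually)
  qed
qed

section \<open>Almost sure growth of \<open>U\<close> by splitting the steps into two blocks\<close>

lemma U_tail_lower:
  assumes \<omega>: "\<omega> \<in> samples" and k: "1 \<le> k" "k \<le> l"
  shows "(\<Sum>j\<in>{int (l - k)..<int (l - 1)}. incr a (2 * real l) (\<omega> j)) / 9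
      \<le> U k ((shift ^^ (l - k)) \<omega>)"
proof -
  define \<omega>' where "\<omega>' = (shift ^^ (l - k)) \<omega>"
  have \<omega>': "\<omega>' \<in> samples" unfolding \<omega>'_def by (rule funpow_shift_samples[OF \<omega>])
  \<comment> \<open>Starting from index 1 with \<open>w = 1\<close>, the correction factor is 9.
    Reaching index \<open>k\<close> takes \<open>k - 1\<close> steps, so the coordinates of
    \<open>\<omega>\<close> involved run from \<open>l - k\<close> to \<open>l - 2\<close>.\<close>
  have "U 1 ((shift ^^ (k - 1)) \<omega>') + (\<Sum>j<k - 1. incr a (2 * real l) (\<omega>' (int j))) / (1 + 2 / 1)\<^sup>2
      \<le> U (1 + (k - 1)) \<omega>'"
    using k by (intro U_lower \<omega>' U_ge_1 funpow_shift_samples) auto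
  moreover have "0 \<le> U 1 ((shift ^^ (k - 1)) \<omega>')" by (simp add: U_def)
  moreover have "(\<Sum>j<k - 1. incr a (2 * real l) (\<omega>' (int j))) =
      (\<Sum>j\<in>{int (l - k)..<int (l - 1)}. incr a (2 * real l) (\<omega> j))"
    using sum_int_interval_shift[of "l - k" "l - 1" "\<lambda>j. incr a (2 * real l) (\<omega> j)"] k
    by (simp add: \<omega>'_def funpow_shift)
  ultimately show ?thesis using k by (simp add: \<omega>'_def)
qed

text \<open>The early block ends at index \<open>k\<close> with a value of at least
  \<open>w\<close>, and coordinates \<open>0\<close> to \<open>l - k - 1\<close> drive the remaining
  \<open>l - k\<close> steps. The value at index \<open>k\<close> is dropped in the lower bound and
  replaced by the linear bound \<open>2 * k\<close> in the upper one.\<close>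

lemma U_sandwich:
  assumes \<omega>: "\<omega> \<in> samples" and k: "1 \<le> k" "k \<le> l"
    and w: "0 < w" "w \<le> U k ((shift ^^ (l - k)) \<omega>)"
  shows "(\<Sum>j\<in>{0..<int (l - k)}. incr a (2 * real l) (\<omega> j)) / (1 + 2 / w)\<^sup>2 \<le> U l \<omega>"
    and "U l \<omega> \<le> 2 * real k + (\<Sum>j\<in>{0..<int (l - k)}. incr a w (\<omega> j))"
proof -
  have sum: "(\<Sum>j<l - k. f (int j)) = sum f {0..<int (l - k)}" for f :: "int \<Rightarrow> real"
    using sum_int_interval_shift[of 0 "l - k" f] by simp
  have "U k ((shift ^^ (l - k)) \<omega>) + (\<Sum>j<l - k. incr a (2 * real l) (\<omega> (int j))) / (1 + 2 / w)\<^sup>2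
      \<le> U (k + (l - k)) \<omega>"
    using k w by (intro U_lower \<omega>) auto
  moreover have "0 \<le> U k ((shift ^^ (l - k)) \<omega>)" by (simp add: U_def)
  ultimately show "(\<Sum>j\<in>{0..<int (l - k)}. incr a (2 * real l) (\<omega> j)) / (1 + 2 / w)\<^sup>2 \<le> U l \<omega>"
    using k unfolding sum[symmetric] by simp
  have "U (k + (l - k)) \<omega> \<le> U k ((shift ^^ (l - k)) \<omega>) + (\<Sum>j<l - k. incr a w (\<omega> (int j)))"
    using k w by (intro U_upper \<omega>) auto
  moreover have "U k ((shift ^^ (l - k)) \<omega>) \<le> 2 * real k"
    using k by (intro U_le funpow_shift_samples \<omega>) auto
  ultimately show "U l \<omega> \<le> 2 * real k + (\<Sum>j\<in>{0..<int (l - k)}. incr a w (\<omega> j))"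
    using k unfolding sum[symmetric] by simp
qed

lemma U_asymp: "AE \<omega> in P_unif a b. (\<lambda>l. U l \<omega> * ln (real l) / real l) \<longlonglongrightarrow> c_unif a b"
proof -
  \<comment> \<open>The early block must be short, so that \<open>2 * k\<close> is negligible
    against \<open>l / ln l\<close>, but long enough that its sum, of order \<open>k / ln l\<close>,
    hence \<open>l / (ln l) ^ 3\<close>, eventually exceeds any constant multiple of
    \<open>w\<close>.\<close>
  define k where "k = (\<lambda>l::nat. nat \<lceil>real l / ln (real l) ^ 2\<rceil>)"
  define w where "w = (\<lambda>l::nat. real l / ln (real l) ^ 4)"
  define J where "J = (\<lambda>l. {0..<int (l - k l)})"
  define J' where "J' = (\<lambda>l. {int (l - k l)..<int (l - 1)})"
  have k: "real l / ln (real l) ^ 2 \<le> real (k l)" "real (k l) \<le> real l / ln (real l) ^ 2 + 1" for l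
  proof -
    have "0 \<le> real l / ln (real l) ^ 2" by simp
    then show "real l / ln (real l) ^ 2 \<le> real (k l)" "real (k l) \<le> real l / ln (real l) ^ 2 + 1"
      unfolding k_def by linarith+
  qed
  have "eventually (\<lambda>l. 1 \<le> real l / ln (real l) ^ 2 \<and> real l / ln (real l) ^ 2 + 1 \<le> real l)
      sequentially"
    by (intro eventually_conj; real_asymp)
  then have k_bounds: "eventually (\<lambda>l. 1 \<le> k l \<and> k l \<le> l) sequentially"
  proof eventually_elim
    case (elim l)
    with k[of l] have "real 1 \<le> real (k l)" "real (k l) \<le> real l" by linarith+
    then show ?case by simp
  qed
  have card: "eventually (\<lambda>l. real (card (J l)) = real l - real (k l) \<and>
      real (card (J' l)) = real (k l) - 1) sequentially"
    using k_bounds by eventually_elim (auto simp: J_def J'_def of_nat_diff)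
  have ln_pos: "eventually (\<lambda>l. 0 < ln (real l)) sequentially" by real_asymp
  have J_large: "filterlim (\<lambda>l. card (J l) / ln (real l) ^ 3) at_top sequentially"
  proof (rule filterlim_at_top_mono)
    show "filterlim (\<lambda>l. (real l - (real l / ln (real l) ^ 2 + 1)) / ln (real l) ^ 3) at_top sequentially"
      by real_asymp
    show "eventually (\<lambda>l. (real l - (real l / ln (real l) ^ 2 + 1)) / ln (real l) ^ 3
        \<le> card (J l) / ln (real l) ^ 3) sequentially"
      using card ln_pos
    proof eventually_elim
      case (elim l)
      with k[of l] show ?case by (intro divide_right_mono) auto
    qed
  qed
  have J'_large: "filterlim (\<lambda>l. card (J' l) / ln (real l) ^ 3) at_top sequentially"
  proof (rule filterlim_at_top_mono)
    show "filterlim (\<lambda>l. (real l / ln (real l) ^ 2 - 1) / ln (real l) ^ 3) at_top sequentially"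
      by real_asymp
    show "eventually (\<lambda>l. (real l / ln (real l) ^ 2 - 1) / ln (real l) ^ 3
        \<le> card (J' l) / ln (real l) ^ 3) sequentially"
      using card ln_pos
    proof eventually_elim
      case (elim l)
      with k[of l] show ?case by (intro divide_right_mono) auto
    qed
  qed
  have k_small: "(\<lambda>l. real (k l) * ln (real l) / real l) \<longlonglongrightarrow> 0"
  proof (rule tendsto_sandwich[OF _ _ tendsto_const])
    show "(\<lambda>l. (real l / ln (real l) ^ 2 + 1) * ln (real l) / real l) \<longlonglongrightarrow> 0" by real_asymp
    show "eventually (\<lambda>l. 0 \<le> real (k l) * ln (real l) / real l) sequentially"
      using ln_pos by eventually_elim simp
    show "eventually (\<lambda>l. real (k l) * ln (real l) / real l \<le>
        (real l / ln (real l) ^ 2 + 1) * ln (real l) / real l) sequentially"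
      using ln_pos by eventually_elim (intro divide_right_mono mult_right_mono k; simp)
  qed
  have card_J: "(\<lambda>l. card (J l) / real l) \<longlonglongrightarrow> 1"
  proof -
    \<comment> \<open>The ratio \<open>k / l\<close> is written as a product so that
      \<open>k_small\<close> applies.\<close>
    have "(\<lambda>l. 1 - real (k l) * ln (real l) / real l * (1 / ln (real l))) \<longlonglongrightarrow> 1 - 0 * 0"
      by (intro tendsto_intros k_small; real_asymp)
    moreover have "eventually (\<lambda>l. 1 - real (k l) * ln (real l) / real l * (1 / ln (real l)) =
        card (J l) / real l) sequentially"
      using card ln_pos eventually_gt_at_top[of 0]
      by eventually_elim (simp add: field_simps)
    ultimately show ?thesis by (auto elim: Lim_transform_eventually)
  qed
  have double: "filterlim (\<lambda>l. 2 * real l) at_top sequentially"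
      "(\<lambda>l. ln (2 * real l) / ln (real l)) \<longlonglongrightarrow> 1"
    by real_asymp+
  have w_top: "filterlim w at_top sequentially" unfolding w_def by real_asymp
  \<comment> \<open>Three frozen sums are controlled almost surely: over the late block at
    \<open>2 * l\<close> for the lower estimate, over the late block at \<open>w\<close> for the
    upper one, and over the early block at \<open>2 * l\<close> to reach \<open>w\<close>. The rest
    is deterministic.\<close>
  have "AE \<omega> in P_unif a b.
      (\<lambda>l. (\<Sum>j\<in>J l. incr a (2 * real l) (\<omega> j)) * ln (real l) / card (J l)) \<longlonglongrightarrow> c_unif a b"
    by (rule incr_sum_asymp[OF _ double J_large]) (simp add: J_def)
  moreover have "AE \<omega> in P_unif a b.
      (\<lambda>l. (\<Sum>j\<in>J l. incr a (w l) (\<omega> j)) * ln (real l) / card (J l)) \<longlonglongrightarrow> c_unif a b"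
  proof (rule incr_sum_asymp[OF _ w_top _ J_large])
    show "(\<lambda>l. ln (w l) / ln (real l)) \<longlonglongrightarrow> 1" unfolding w_def by real_asymp
  qed (simp add: J_def)
  moreover have "AE \<omega> in P_unif a b.
      (\<lambda>l. (\<Sum>j\<in>J' l. incr a (2 * real l) (\<omega> j)) * ln (real l) / card (J' l)) \<longlonglongrightarrow> c_unif a b"
    by (rule incr_sum_asymp[OF _ double J'_large]) (simp add: J'_def)
  ultimately show ?thesis
    using AE_space
  proof eventually_elim
    case (elim \<omega>)
    define S1 where "S1 l = (\<Sum>j\<in>J l. incr a (2 * real l) (\<omega> j))" for l
    define S2 where "S2 l = (\<Sum>j\<in>J l. incr a (w l) (\<omega> j))" for l
    define S3 where "S3 l = (\<Sum>j\<in>J' l. incr a (2 * real l) (\<omega> j))" for l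
    note S = elim(1-3)[folded S1_def S2_def S3_def]
    have \<omega>: "\<omega> \<in> samples" using elim(4) by (simp add: space_P_unif)
    \<comment> \<open>Half of the limit constant leaves room to pass from the limit of
      \<open>S3\<close> to an eventual inequality; the divisor 9 comes from
      \<open>U_tail_lower\<close>.\<close>
    have "eventually (\<lambda>l. real l / ln (real l) ^ 4 \<le>
        c_unif a b / 2 * (real l / ln (real l) ^ 2 - 1) / ln (real l) / 9) sequentially"
      using c_unif_pos by real_asymp
    moreover have "c_unif a b / 2 < c_unif a b" using c_unif_pos by simp
    note order_tendstoD(1)[OF S(3) this]
    moreover have "eventually (\<lambda>l. 1 < real l / ln (real l) ^ 2) sequentially" by real_asymp
    ultimately have w_le: "eventually (\<lambda>l. w l \<le> S3 l / 9) sequentially"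
      using card ln_pos
    proof eventually_elim
      case (elim l)
      have kl: "real l / ln (real l) ^ 2 - 1 \<le> real (k l) - 1" "0 < real (k l) - 1"
        using k(1)[of l] elim by linarith+
      have "c_unif a b / 2 * (real l / ln (real l) ^ 2 - 1) \<le> c_unif a b / 2 * (real (k l) - 1)"
        using kl c_unif_pos by (intro mult_left_mono) auto
      also have "\<dots> \<le> S3 l * ln (real l)"
        using elim kl by (simp add: field_simps)
      finally have S3: "c_unif a b / 2 * (real l / ln (real l) ^ 2 - 1) / ln (real l) \<le> S3 l"
        using elim by (subst pos_divide_le_eq) auto
      have "w l \<le> c_unif a b / 2 * (real l / ln (real l) ^ 2 - 1) / ln (real l) / 9"
        using elim by (simp only: w_def)
      also have "\<dots> \<le> S3 l / 9"
        using S3 by (rule divide_right_mono) simp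
      finally show ?case .
    qed
    have sandwich: "eventually (\<lambda>l. S1 l / (1 + 2 / w l)\<^sup>2 \<le> U l \<omega> \<and>
        U l \<omega> \<le> 2 * real (k l) + S2 l) sequentially"
      using w_le k_bounds filterlim_at_top_dense[THEN iffD1, OF w_top, rule_format, of 0]
    proof eventually_elim
      case (elim l)
      have "S3 l / 9 \<le> U (k l) ((shift ^^ (l - k l)) \<omega>)"
        unfolding S3_def J'_def using elim by (intro U_tail_lower \<omega>) auto
      with elim have "w l \<le> U (k l) ((shift ^^ (l - k l)) \<omega>)" by linarith
      with U_sandwich[OF \<omega>, of "k l" l "w l"] elim show ?case
        by (simp add: S1_def S2_def J_def)
    qed
    have scale: "(\<lambda>l. T l * ln (real l) / real l) \<longlonglongrightarrow> c_unif a b"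
      if "(\<lambda>l. T l * ln (real l) / card (J l)) \<longlonglongrightarrow> c_unif a b" for T :: "nat \<Rightarrow> real"
    proof -
      have "(\<lambda>l. T l * ln (real l) / card (J l) * (card (J l) / real l)) \<longlonglongrightarrow> c_unif a b * 1"
        by (intro tendsto_mult that card_J)
      moreover have "eventually (\<lambda>l. T l * ln (real l) / card (J l) * (card (J l) / real l) =
          T l * ln (real l) / real l) sequentially"
        using order_tendstoD(1)[OF card_J, of 0] by (auto elim!: eventually_mono)
      ultimately show ?thesis by (auto elim: Lim_transform_eventually)
    qed
    show ?case
    proof (rule tendsto_sandwich)
      \<comment> \<open>As \<open>w\<close> tends to infinity, the correction factor tends to 1 and
        the lower bound keeps the full constant.\<close>
      have "(\<lambda>l. 1 + 2 / w l) \<longlonglongrightarrow> 1 + 0"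
        by (intro tendsto_intros tendsto_divide_0[OF tendsto_const]
              filterlim_at_top_imp_at_infinity w_top)
      from tendsto_divide[OF scale[OF S(1)] tendsto_power[OF this, of 2]]
      show "(\<lambda>l. S1 l * ln (real l) / real l / (1 + 2 / w l)\<^sup>2) \<longlonglongrightarrow> c_unif a b" by simp
      have "(\<lambda>l. 2 * (real (k l) * ln (real l) / real l) + S2 l * ln (real l) / real l)
          \<longlonglongrightarrow> 2 * 0 + c_unif a b"
        by (intro tendsto_intros k_small scale S(2))
      then show "(\<lambda>l. 2 * (real (k l) * ln (real l) / real l) + S2 l * ln (real l) / real l)
          \<longlonglongrightarrow> c_unif a b" by simp
      show "eventually (\<lambda>l. S1 l * ln (real l) / real l / (1 + 2 / w l)\<^sup>2 \<le>
          U l \<omega> * ln (real l) / real l) sequentially"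
        using sandwich ln_pos
      proof eventually_elim
        case (elim l)
        then have "S1 l / (1 + 2 / w l)\<^sup>2 * (ln (real l) / real l) \<le> U l \<omega> * (ln (real l) / real l)"
          by (intro mult_right_mono) auto
        then show ?case by (simp add: mult_ac)
      qed
      show "eventually (\<lambda>l. U l \<omega> * ln (real l) / real l \<le>
          2 * (real (k l) * ln (real l) / real l) + S2 l * ln (real l) / real l) sequentially"
        using sandwich ln_pos
      proof eventually_elim
        case (elim l)
        then have "U l \<omega> * (ln (real l) / real l) \<le> (2 * real (k l) + S2 l) * (ln (real l) / real l)"
          by (intro mult_right_mono) auto
        then show ?case by (simp add: algebra_simps add_divide_distrib)
      qed
    qed
  qed
qed

text \<open>Raising the normalised limit of \<open>U\<close> to the power \<open>- 1 / a\<close>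
  undoes the change of coordinate and gives the required quotient exactly.\<close>

lemma xseq_asymp:
  assumes "\<omega> \<in> samples" "(\<lambda>l. U l \<omega> * ln (real l) / real l) \<longlonglongrightarrow> c_unif a b"
  shows "(\<lambda>l. xseq l \<omega> / (ln (real l) / (c_unif a b * real l)) powr (1 / a)) \<longlonglongrightarrow> 1"
proof -
  have "(\<lambda>l. (U l \<omega> * ln (real l) / real l / c_unif a b) powr (- 1 / a)) \<longlonglongrightarrow>
      (c_unif a b / c_unif a b) powr (- 1 / a)"
    using c_unif_pos a_pos by (intro tendsto_intros assms(2)) auto
  moreover have "eventually (\<lambda>l. (U l \<omega> * ln (real l) / real l / c_unif a b) powr (- 1 / a) =
      xseq l \<omega> / (ln (real l) / (c_unif a b * real l)) powr (1 / a)) sequentially"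
    \<comment> \<open>Taking \<open>l > 1\<close> makes \<open>ln (real l)\<close> positive and
      avoids index 0, where \<open>xseq\<close> is unspecified.\<close>
    using eventually_gt_at_top[of 1]
  proof eventually_elim
    case (elim l)
    define q where "q = ln (real l) / (c_unif a b * real l)"
    have "0 < q" using elim c_unif_pos by (simp add: q_def)
    obtain m where "l = Suc m" using elim by (cases l) auto
    then have x: "0 < xseq l \<omega>" using xseq_bounds[OF assms(1), of m] by simp
    have "U l \<omega> * ln (real l) / real l / c_unif a b = U l \<omega> * q" by (simp add: q_def mult_ac)
    also have "\<dots> powr (- 1 / a) = U l \<omega> powr (- 1 / a) * q powr (- 1 / a)"
      by (rule powr_mult)
    also have "U l \<omega> powr (- 1 / a) = xseq l \<omega>"
      using x a_pos by (simp add: U_def powr_powr)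
    also have "xseq l \<omega> * q powr (- 1 / a) = xseq l \<omega> / q powr (1 / a)"
      by (simp add: powr_minus divide_inverse)
    finally show ?case by (simp add: q_def)
  qed
  ultimately show ?thesis using c_unif_pos by (auto elim: Lim_transform_eventually)
qed

end

theorem proposition5p7:
  fixes \<alpha>\<^sub>0 \<alpha>\<^sub>1 :: real
  assumes "0 < \<alpha>\<^sub>0" "\<alpha>\<^sub>0 < \<alpha>\<^sub>1" "\<alpha>\<^sub>1 < 1"
  shows "AE \<omega> in P_unif \<alpha>\<^sub>0 \<alpha>\<^sub>1.
           (\<lambda>l. xseq l \<omega> / ((ln (real l) / (c_unif \<alpha>\<^sub>0 \<alpha>\<^sub>1 * real l)) powr (1 / \<alpha>\<^sub>0)))
             \<longlonglongrightarrow> 1"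
proof -
  interpret lsv_params \<alpha>\<^sub>0 \<alpha>\<^sub>1 using assms by unfold_locales
  show ?thesis
    using AE_space U_asymp by eventually_elim (rule xseq_asymp, simp_all add: space_P_unif)
qed

end
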